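(* Let $A_c\in\mathbb{R}^{n\times n}$ and let $\mathcal{P}=\mathrm{conv}\{x^1,\dots,x^\ell\}\subset\mathbb{R}^n$ be a polytope with vertices $x^1,\dots,x^\ell$ that is an invariant set for the continuous system $\dot x(t)=A_cx(t)$. For $i=1,\dots,\ell$ let $$\sigma_i=\min\Big\{\sum_{j\ne i}\gamma_j^{(i)}\ \Big|\ \sum_{j\neq i}\gamma_j^{(i)}(x^j-x^i)=A_cx^i,\ \gamma_j^{(i)}\ge 0\Big\},\qquad \epsilon^i=\sigma_i^{-1}$$ (with $\epsilon^i=\infty$ if $\sigma_i=0$). Then $\tau=\min_{i=1,\dots,\ell}\epsilon^i$ is the largest steplength threshold $\tau>0$ for invariance preserving on $\mathcal{P}$ of the forward Euler method $x_{k+1}=(I+\Delta t\,A_c)x_k$.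
   Context: A set $\mathcal{S}\subseteq\mathbb{R}^n$ is an invariant set for $\dot x(t)=A_cx(t)$ if $x(0)\in\mathcal{S}$ implies $x(t)\in\mathcal{S}$ for all $t\ge 0$; it is an invariant set for $x_{k+1}=A_dx_k$ if $x_k\in\mathcal{S}$ implies $x_{k+1}\in\mathcal{S}$ for all $k\in\mathbb{N}$ (equivalently $A_d\mathcal{S}\subseteq\mathcal{S}$). Let $\mathcal{P}$ be an invariant set for the continuous system and let a discretization method with steplength $\Delta t$ be applied to it, giving a discrete system. A number $\tau>0$ is a (valid) steplength threshold for invariance preserving of the method on $\mathcal{P}$ if $\mathcal{P}$ is an invariant set for the discrete system for every $\Delta t\in[0,\tau]$ (for every $\Delta t\ge0$ if $\tau=\infty$). *)

theory Defs
  imports "HOL-Analysis.Analysis"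
begin

definition continuous_solution :: "real^'n^'n \<Rightarrow> (real \<Rightarrow> real^'n) \<Rightarrow> bool" where
  "continuous_solution A x \<longleftrightarrow>
     (\<forall>t\<ge>0. (x has_vector_derivative A *v x t) (at t within {0..}))"

definition continuous_invariant :: "real^'n^'n \<Rightarrow> (real^'n) set \<Rightarrow> bool" where
  "continuous_invariant A S \<longleftrightarrow>
     (\<forall>x. continuous_solution A x \<longrightarrow> x 0 \<in> S \<longrightarrow> (\<forall>t\<ge>0. x t \<in> S))"

definition discrete_solution :: "real^'n^'n \<Rightarrow> (nat \<Rightarrow> real^'n) \<Rightarrow> bool" where
  "discrete_solution A x \<longleftrightarrow> (\<forall>k. x (Suc k) = A *v x k)"

definition discrete_invariant :: "real^'n^'n \<Rightarrow> (real^'n) set \<Rightarrow> bool" where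
  "discrete_invariant A S \<longleftrightarrow>
     (\<forall>x. discrete_solution A x \<longrightarrow> (\<forall>k. x k \<in> S \<longrightarrow> x (Suc k) \<in> S))"

text \<open>A discretization method applied to a fixed continuous system is given by the map \<open>D\<close>
  from the steplength to the coefficient matrix of the resulting discrete system.
  Thresholds are extended reals: for \<open>\<tau> = \<infinity>\<close> every steplength is admitted.\<close>

definition steplength_threshold ::
    "(real \<Rightarrow> real^'n^'n) \<Rightarrow> (real^'n) set \<Rightarrow> ereal \<Rightarrow> bool" where
  "steplength_threshold D S \<tau> \<longleftrightarrow>
     0 < \<tau> \<and> (\<forall>dt\<ge>0. ereal dt \<le> \<tau> \<longrightarrow> discrete_invariant (D dt) S)"

definition largest_steplength_threshold ::
    "(real \<Rightarrow> real^'n^'n) \<Rightarrow> (real^'n) set \<Rightarrow> ereal \<Rightarrow> bool" where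
  "largest_steplength_threshold D S \<tau> \<longleftrightarrow>
     steplength_threshold D S \<tau> \<and> (\<forall>\<tau>'. steplength_threshold D S \<tau>' \<longrightarrow> \<tau>' \<le> \<tau>)"

definition forward_euler :: "real^'n^'n \<Rightarrow> real \<Rightarrow> real^'n^'n" where
  "forward_euler A dt = mat 1 + dt *\<^sub>R A"

definition sigma_values :: "real^'n^'n \<Rightarrow> nat \<Rightarrow> (nat \<Rightarrow> real^'n) \<Rightarrow> nat \<Rightarrow> real set" where
  "sigma_values A l x i =
     {(\<Sum>j\<in>{1..l} - {i}. \<gamma> j) | \<gamma> :: nat \<Rightarrow> real.
        (\<Sum>j\<in>{1..l} - {i}. \<gamma> j *\<^sub>R (x j - x i)) = A *v x i \<and>
        (\<forall>j\<in>{1..l} - {i}. 0 \<le> \<gamma> j)}"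

text \<open>\<open>LEAST\<close> is the minimum of the set and is unspecified if no minimum exists.\<close>

definition vertex_sigma :: "real^'n^'n \<Rightarrow> nat \<Rightarrow> (nat \<Rightarrow> real^'n) \<Rightarrow> nat \<Rightarrow> real" where
  "vertex_sigma A l x i = (LEAST s. s \<in> sigma_values A l x i)"

definition vertex_epsilon :: "real^'n^'n \<Rightarrow> nat \<Rightarrow> (nat \<Rightarrow> real^'n) \<Rightarrow> nat \<Rightarrow> ereal" where
  "vertex_epsilon A l x i =
     (if vertex_sigma A l x i = 0 then \<infinity> else ereal (inverse (vertex_sigma A l x i)))"

end

theory Submission
  imports Defs
begin

text \<open>
  A discrete system leaves a polytope invariant iff it maps every vertex into the polytope, because
  its map is linear. For the forward Euler method and a vertex \<open>x i\<close> the image is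
  \<open>x i + dt *\<^sub>R (A *v x i)\<close>, and a point \<open>y\<close> lies in the polytope iff \<open>y - x i\<close> is a combination of
  the edges \<open>x j - x i\<close> with nonnegative coefficients of total weight at most \<open>1\<close>. Dividing such a
  representation of \<open>dt *\<^sub>R (A *v x i)\<close> by \<open>dt\<close>, respectively multiplying an optimal representation
  of \<open>A *v x i\<close> by \<open>dt\<close>, shows that the Euler step stays in the polytope iff \<open>dt\<close> times the minimal
  weight is at most \<open>1\<close> (lemma \<open>euler_step_in_hull_iff\<close>). Hence the method preserves invariance for
  exactly those \<open>dt \<ge> 0\<close> that are at most every vertex bound.

  It remains to see that the minimal weights exist. The representations of \<open>A *v x i\<close> form a nonempty
  set because the trajectory from \<open>x i\<close> stays in the polytope: its difference quotients at time \<open>0\<close>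
  lie in the cone generated by the edges, which is closed, so their limit \<open>A *v x i\<close> lies in it too
  (lemma \<open>sigma_values_nonempty\<close>). The minimum is attained because \<open>s\<close> is an admissible weight iff
  \<open>(s, A *v x i)\<close> lies in the finitely generated, hence closed, cone spanned by the pairs
  \<open>(1, x j - x i)\<close>; the set of weights is thus closed, and it is bounded below by \<open>0\<close>
  (lemma \<open>vertex_sigma_is_minimum\<close>).
\<close>

section \<open>Trajectories of the linear system\<close>

text \<open>Without existence of a trajectory from each point, invariance could hold vacuously. The solution
  is the exponential series applied to \<open>v\<close>, treated as one real power series per coordinate.\<close>

lemma ex_continuous_solution:
  fixes A :: "real^'n^'n" and v :: "real^'n"
  obtains x where "continuous_solution A x" "x 0 = v"
proof -
  define w where "w k = ((*v) A ^^ k) v" for k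
  have w_Suc: "w (Suc k) = A *v w k" for k by (simp add: w_def)
  obtain K where K: "K > 0" "\<And>y. norm (A *v y) \<le> norm y * K"
    using bounded_linear.pos_bounded[OF matrix_vector_mul_bounded_linear[of A]] by blast
  have norm_w: "norm (w k) \<le> norm v * K ^ k" for k
  proof (induction k)
    case (Suc k)
    have "norm (w (Suc k)) \<le> norm (w k) * K" using K(2) by (simp add: w_Suc)
    also have "\<dots> \<le> norm v * K ^ k * K" using Suc K(1) by (intro mult_right_mono) auto
    finally show ?case by (simp add: mult_ac)
  qed (simp add: w_def)
  \<comment> \<open>Coefficients of the \<open>i\<close>-th coordinate of the exponential series applied to \<open>v\<close>.\<close>
  define c where "c i k = w k $ i / fact k" for i :: 'n and k
  have summable_c: "summable (\<lambda>k. c i k * t ^ k)" for i and t :: real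
  proof (rule summable_comparison_test')
    show "summable (\<lambda>k. norm v * (inverse (fact k) * (K * \<bar>t\<bar>) ^ k))"
      by (intro summable_mult summable_exp)
    fix k :: nat
    have "\<bar>w k $ i\<bar> \<le> norm v * K ^ k"
      using component_le_norm_cart norm_w by (rule order_trans)
    then have "\<bar>w k $ i\<bar> * (inverse (fact k) * \<bar>t\<bar> ^ k)
        \<le> norm v * K ^ k * (inverse (fact k) * \<bar>t\<bar> ^ k)"
      by (intro mult_right_mono) auto
    then show "norm (c i k * t ^ k) \<le> norm v * (inverse (fact k) * (K * \<bar>t\<bar>) ^ k)"
      by (simp add: c_def abs_mult power_abs power_mult_distrib field_simps)
  qed
  define x where "x t = (\<chi> i. \<Sum>k. c i k * t ^ k)" for t
  have diffs_c: "diffs (c i) k = (\<Sum>j\<in>UNIV. A $ i $ j * c j k)" for i k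
  proof -
    have "diffs (c i) k = (A *v w k) $ i / fact k"
      by (simp add: diffs_def c_def w_Suc field_simps del: of_nat_Suc)
    then show ?thesis
      by (simp add: matrix_vector_mult_def c_def sum_divide_distrib)
  qed
  have Ax: "(A *v x t) $ i = (\<Sum>k. diffs (c i) k * t ^ k)" for i t
  proof -
    have "(A *v x t) $ i = (\<Sum>j\<in>UNIV. \<Sum>k. A $ i $ j * (c j k * t ^ k))"
      by (simp add: matrix_vector_mult_def x_def suminf_mult summable_c)
    also have "\<dots> = (\<Sum>k. \<Sum>j\<in>UNIV. A $ i $ j * (c j k * t ^ k))"
      by (intro suminf_sum[symmetric] summable_mult summable_c)
    finally show ?thesis by (simp add: diffs_c sum_distrib_right mult.assoc)
  qed
  have "(x has_vector_derivative A *v x t) (at t within {0..})" for t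
  proof -
    have "((\<lambda>t. x t $ i) has_real_derivative (A *v x t) $ i) (at t)" for i
      using termdiffs_strong_converges_everywhere[OF summable_c, of i t]
      by (simp add: Ax) (simp add: x_def)
    then have "((\<lambda>t. x t $ i) has_real_derivative (A *v x t) $ i) (at t within {0..})" for i
      by (rule has_field_derivative_at_within)
    then have "((\<lambda>t. x t $ i) has_derivative (\<lambda>h. (h *\<^sub>R (A *v x t)) $ i)) (at t within {0..})" for i
      by (simp add: has_field_derivative_def mult_commute_abs)
    then show ?thesis
      unfolding has_vector_derivative_def
      by (subst has_derivative_componentwise_within) (auto simp: Basis_vec_def inner_axis)
  qed
  moreover have "x 0 = v"
  proof (rule vec_eq_iff[THEN iffD2], rule allI)
    show "x 0 $ i = v $ i" for i
      using powser_zero[of "c i"] by (simp add: x_def c_def w_def)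
  qed
  ultimately show thesis
    using that unfolding continuous_solution_def by blast
qed

text \<open>The vector field of an invariant system points into every closed convex cone that contains
  \<open>S - v\<close>, since the difference quotients of the trajectory from \<open>v\<close> lie in that cone.\<close>

lemma continuous_invariant_imp_direction_in_cone:
  fixes A :: "real^'n^'n"
  assumes inv: "continuous_invariant A S" and "v \<in> S"
    and C: "closed C" "convex_cone C" and diff: "\<And>y. y \<in> S \<Longrightarrow> y - v \<in> C"
  shows "A *v v \<in> C"
proof -
  obtain x where x: "continuous_solution A x" "x 0 = v" by (rule ex_continuous_solution)
  have "(x has_vector_derivative A *v v) (at 0 within {0..})"
    using x by (auto simp: continuous_solution_def)
  then have "((\<lambda>t. (1 / norm (t - 0)) *\<^sub>R (x t - (x 0 + (t - 0) *\<^sub>R (A *v v)))) \<longlongrightarrow> 0)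
      (at 0 within {0..})"
    unfolding has_vector_derivative_def has_derivative_within by blast
  then have "((\<lambda>t. inverse t *\<^sub>R (x t - v) - A *v v) \<longlongrightarrow> 0) (at 0 within {0..})"
  proof (rule Lim_transform_eventually)
    have "(1 / norm (t - 0)) *\<^sub>R (x t - (x 0 + (t - 0) *\<^sub>R (A *v v)))
        = inverse t *\<^sub>R (x t - v) - A *v v" if "t > 0" for t
      using that x(2) by (simp add: scaleR_diff_right scaleR_add_right divide_inverse)
    then show "\<forall>\<^sub>F t in at 0 within {0..}. (1 / norm (t - 0)) *\<^sub>R (x t - (x 0 + (t - 0) *\<^sub>R (A *v v)))
        = inverse t *\<^sub>R (x t - v) - A *v v"
      by (simp add: eventually_at_filter)
  qed
  then have lim: "((\<lambda>t. inverse t *\<^sub>R (x t - v)) \<longlongrightarrow> A *v v) (at 0 within {0..})"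
    by (rule LIM_zero_cancel)
  have ev: "\<forall>\<^sub>F t in at 0 within {0..}. inverse t *\<^sub>R (x t - v) \<in> C"
  proof -
    have "inverse t *\<^sub>R (x t - v) \<in> C" if "t \<in> {0..}" for t
      using that inv x \<open>v \<in> S\<close> diff unfolding continuous_invariant_def
      by (intro convex_cone_scaleR[OF C(2)]) auto
    then show ?thesis by (simp add: eventually_at_filter)
  qed
  have "at (0::real) within {0..} \<noteq> bot"
    by (simp add: at_within_Ici_at_right)
  then show ?thesis
    by (rule Lim_in_closed_set[OF C(1) ev _ lim])
qed

section \<open>Finitely generated cones and convex hulls\<close>

lemma in_convex_cone_hull_image_iff:
  assumes "finite J"
  shows "y \<in> convex_cone hull (v ` J) \<longleftrightarrow>
    (\<exists>\<gamma>. (\<forall>j\<in>J. 0 \<le> \<gamma> j) \<and> y = (\<Sum>j\<in>J. \<gamma> j *\<^sub>R v j))"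
proof -
  let ?C = "{\<Sum>j\<in>J. \<gamma> j *\<^sub>R v j | \<gamma> :: _ \<Rightarrow> real. \<forall>j\<in>J. 0 \<le> \<gamma> j}"
  have "convex_cone hull (v ` J) = ?C"
  proof (rule hull_unique)
    show "v ` J \<subseteq> ?C"
    proof
      fix y assume "y \<in> v ` J"
      then obtain k where k: "k \<in> J" "y = v k" by blast
      then have "y = (\<Sum>j\<in>J. (if j = k then 1 else 0 :: real) *\<^sub>R v j)"
        using assms by (simp add: if_distrib[of "\<lambda>a. a *\<^sub>R _"] cong: if_cong)
      then show "y \<in> ?C" by fastforce
    qed
    show "convex_cone ?C"
      unfolding convex_cone_iff
    proof (intro conjI ballI allI impI)
      show "0 \<in> ?C" by (auto intro!: exI[of _ "\<lambda>_. 0"])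
      show "y + z \<in> ?C" if "y \<in> ?C" "z \<in> ?C" for y z
      proof -
        from that obtain f g where "\<forall>j\<in>J. 0 \<le> f j" "y = (\<Sum>j\<in>J. f j *\<^sub>R v j)"
          "\<forall>j\<in>J. 0 \<le> g j" "z = (\<Sum>j\<in>J. g j *\<^sub>R v j)" by auto
        then show ?thesis
          by (auto simp: scaleR_left_distrib sum.distrib intro!: exI[of _ "\<lambda>j. f j + g j"])
      qed
      show "a *\<^sub>R y \<in> ?C" if "y \<in> ?C" "0 \<le> a" for y a
      proof -
        from that obtain f where "\<forall>j\<in>J. 0 \<le> f j" "y = (\<Sum>j\<in>J. f j *\<^sub>R v j)" by auto
        then show ?thesis
          using that by (auto simp: scaleR_sum_right intro!: exI[of _ "\<lambda>j. a * f j"])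
      qed
    qed
    show "?C \<subseteq> T" if "v ` J \<subseteq> T" "convex_cone T" for T
    proof
      fix y assume "y \<in> ?C"
      then obtain \<gamma> where \<gamma>: "\<forall>j\<in>J. 0 \<le> \<gamma> j" "y = (\<Sum>j\<in>J. \<gamma> j *\<^sub>R v j)" by blast
      have "(\<Sum>j\<in>I. \<gamma> j *\<^sub>R v j) \<in> T" if "finite I" "I \<subseteq> J" for I
        using that
        by (induction I) (use \<gamma> \<open>v ` J \<subseteq> T\<close> \<open>convex_cone T\<close> in
          \<open>auto intro!: convex_cone_add convex_cone_scaleR convex_cone_contains_0\<close>)
      then show "y \<in> T" using assms \<gamma>(2) by blast
    qed
  qed
  then show ?thesis by auto
qed

text \<open>Barycentric coordinates with the weight of the point \<open>x i\<close> eliminated: that weight is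
  \<open>1\<close> minus the sum of the others, so only the inequality for the sum remains.\<close>

lemma in_convex_hull_image_iff_edge_sum:
  fixes x :: "'i \<Rightarrow> 'a::euclidean_space"
  assumes I: "finite I" "i \<in> I"
  shows "y \<in> convex hull (x ` I) \<longleftrightarrow>
    (\<exists>\<gamma>. (\<forall>j\<in>I - {i}. 0 \<le> \<gamma> j) \<and> (\<Sum>j\<in>I - {i}. \<gamma> j) \<le> 1 \<and>
         y - x i = (\<Sum>j\<in>I - {i}. \<gamma> j *\<^sub>R (x j - x i)))"
    (is "_ \<longleftrightarrow> ?R")
proof -
  \<comment> \<open>Viewing the points as singletons indexed by \<open>I\<close> gives coefficients indexed by \<open>I\<close> even
     when \<open>x\<close> is not injective.\<close>
  have "x ` I = \<Union>((\<lambda>j. {x j}) ` I)" by auto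
  then have "convex hull (x ` I) =
      {(\<Sum>j\<in>I. c j *\<^sub>R s j) | c s. (\<forall>j\<in>I. c j \<ge> 0) \<and> sum c I = 1 \<and> (\<forall>j\<in>I. s j \<in> {x j})}"
    using convex_hull_finite_union[OF I(1), of "\<lambda>j. {x j}"] by simp
  also have "\<dots> = {(\<Sum>j\<in>I. c j *\<^sub>R x j) | c. (\<forall>j\<in>I. c j \<ge> 0) \<and> sum c I = 1}" (is "?B = ?C")
  proof
    show "?B \<subseteq> ?C"
    proof
      fix z assume "z \<in> ?B"
      then obtain c s where c: "z = (\<Sum>j\<in>I. c j *\<^sub>R s j)" "\<forall>j\<in>I. c j \<ge> 0" "sum c I = 1"
        and s: "\<forall>j\<in>I. s j = x j" by auto
      then have "z = (\<Sum>j\<in>I. c j *\<^sub>R x j)" by simp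
      then show "z \<in> ?C" using c by blast
    qed
    show "?C \<subseteq> ?B" by blast
  qed
  finally have hull: "y \<in> convex hull (x ` I) \<longleftrightarrow>
      (\<exists>c. y = (\<Sum>j\<in>I. c j *\<^sub>R x j) \<and> (\<forall>j\<in>I. c j \<ge> 0) \<and> sum c I = 1)" by simp
  have split: "(\<Sum>j\<in>I. c j *\<^sub>R x j) = c i *\<^sub>R x i + (\<Sum>j\<in>I - {i}. c j *\<^sub>R x j)"
    "sum c I = c i + sum c (I - {i})" for c :: "'i \<Rightarrow> real"
    using I by (simp_all add: sum.remove)
  have edges: "(\<Sum>j\<in>I - {i}. c j *\<^sub>R (x j - x i)) =
      (\<Sum>j\<in>I - {i}. c j *\<^sub>R x j) - sum c (I - {i}) *\<^sub>R x i" for c :: "'i \<Rightarrow> real"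
    by (simp add: scaleR_diff_right sum_subtractf scaleR_sum_left)
  show ?thesis
  proof
    assume "y \<in> convex hull (x ` I)"
    then obtain c where c: "y = (\<Sum>j\<in>I. c j *\<^sub>R x j)" "\<forall>j\<in>I. c j \<ge> 0" "sum c I = 1"
      using hull by blast
    have ci: "c i = 1 - sum c (I - {i})" using c(3) split(2)[of c] by simp
    have "y - x i = (\<Sum>j\<in>I - {i}. c j *\<^sub>R (x j - x i))"
      unfolding edges c(1) split(1) ci by (simp add: scaleR_diff_left)
    moreover have "sum c (I - {i}) \<le> 1" using ci c(2) I(2) by force
    ultimately show ?R using c(2) by blast
  next
    assume ?R
    then obtain c where c: "\<forall>j\<in>I - {i}. 0 \<le> c j" "sum c (I - {i}) \<le> 1"
      "y - x i = (\<Sum>j\<in>I - {i}. c j *\<^sub>R (x j - x i))" by blast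
    define d where "d = c(i := 1 - sum c (I - {i}))"
    have d: "(\<Sum>j\<in>I - {i}. d j *\<^sub>R x j) = (\<Sum>j\<in>I - {i}. c j *\<^sub>R x j)"
      "sum d (I - {i}) = sum c (I - {i})" "d i = 1 - sum c (I - {i})"
      by (auto simp: d_def intro!: sum.cong)
    have "y = x i + ((\<Sum>j\<in>I - {i}. c j *\<^sub>R x j) - sum c (I - {i}) *\<^sub>R x i)"
      using c(3) unfolding edges by (simp add: algebra_simps)
    also have "\<dots> = (\<Sum>j\<in>I. d j *\<^sub>R x j)"
      unfolding split d by (simp add: scaleR_diff_left)
    finally have "y = (\<Sum>j\<in>I. d j *\<^sub>R x j)" .
    moreover have "\<forall>j\<in>I. d j \<ge> 0" using c by (auto simp: d_def)
    moreover have "sum d I = 1" unfolding split d by simp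
    ultimately show "y \<in> convex hull (x ` I)" using hull by blast
  qed
qed

section \<open>Invariance for discrete systems\<close>

lemma discrete_invariant_iff:
  "discrete_invariant D S \<longleftrightarrow> (\<forall>y\<in>S. D *v y \<in> S)"
proof
  assume inv: "discrete_invariant D S"
  show "\<forall>y\<in>S. D *v y \<in> S"
  proof
    fix y assume "y \<in> S"
    define z where "z k = ((*v) D ^^ k) y" for k
    have "discrete_solution D z" by (simp add: discrete_solution_def z_def)
    moreover have "z 0 \<in> S" using \<open>y \<in> S\<close> by (simp add: z_def)
    ultimately have "z (Suc 0) \<in> S" using inv unfolding discrete_invariant_def by blast
    then show "D *v y \<in> S" by (simp add: z_def)
  qed
qed (auto simp: discrete_invariant_def discrete_solution_def)

lemma discrete_invariant_convex_hull_iff: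
  "discrete_invariant D (convex hull V) \<longleftrightarrow> (\<forall>v\<in>V. D *v v \<in> convex hull V)"
proof
  assume "discrete_invariant D (convex hull V)"
  then show "\<forall>v\<in>V. D *v v \<in> convex hull V"
    by (simp add: discrete_invariant_iff hull_inc)
next
  assume V: "\<forall>v\<in>V. D *v v \<in> convex hull V"
  \<comment> \<open>The points that the map sends into the hull form a convex set containing \<open>V\<close>.\<close>
  have "convex ((*v) D -` (convex hull V))"
    by (intro convex_linear_vimage convex_convex_hull matrix_vector_mul_linear)
  with V have "convex hull V \<subseteq> (*v) D -` (convex hull V)"
    by (intro hull_minimal) auto
  then show "discrete_invariant D (convex hull V)"
    by (auto simp: discrete_invariant_iff)
qed

section \<open>The minimal weights at the vertices\<close>

text \<open>The leading coordinate \<open>1\<close> of each generator records the total weight of a conic combination.\<close>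

lemma in_sigma_values_iff_cone:
  "s \<in> sigma_values A l x i \<longleftrightarrow>
    (s, A *v x i) \<in> convex_cone hull ((\<lambda>j. (1, x j - x i)) ` ({1..l} - {i}))"
  by (auto simp: sigma_values_def in_convex_cone_hull_image_iff prod_eq_iff fst_sum snd_sum)

lemma sigma_values_nonneg: "s \<in> sigma_values A l x i \<Longrightarrow> 0 \<le> s"
  by (auto simp: sigma_values_def intro!: sum_nonneg)

lemma sigma_values_nonempty:
  assumes i: "i \<in> {1..l}" and inv: "continuous_invariant A (convex hull (x ` {1..l}))"
  shows "sigma_values A l x i \<noteq> {}"
proof -
  let ?C = "convex_cone hull ((\<lambda>j. x j - x i) ` ({1..l} - {i}))"
  have "A *v x i \<in> ?C"
  proof (rule continuous_invariant_imp_direction_in_cone[OF inv])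
    show "x i \<in> convex hull (x ` {1..l})" using i by (simp add: hull_inc)
    show "closed ?C" by (intro closed_convex_cone_hull) simp
    show "convex_cone ?C" by (rule convex_cone_convex_cone_hull)
    show "y - x i \<in> ?C" if "y \<in> convex hull (x ` {1..l})" for y
      using that in_convex_hull_image_iff_edge_sum[OF _ i, of y x]
      by (auto simp: in_convex_cone_hull_image_iff)
  qed
  then show ?thesis
    by (auto simp: in_convex_cone_hull_image_iff sigma_values_def)
qed

lemma vertex_sigma_is_minimum:
  assumes "sigma_values A l x i \<noteq> {}"
  shows "vertex_sigma A l x i \<in> sigma_values A l x i"
    and "s \<in> sigma_values A l x i \<Longrightarrow> vertex_sigma A l x i \<le> s"
proof -
  let ?S = "sigma_values A l x i" and ?C = "convex_cone hull ((\<lambda>j. (1::real, x j - x i)) ` ({1..l} - {i}))"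
  have "?S = (\<lambda>s. (s, A *v x i)) -` ?C"
    by (auto simp: in_sigma_values_iff_cone)
  moreover have "closed ?C" by (intro closed_convex_cone_hull) simp
  ultimately have "closed ?S"
    by (auto intro!: closed_vimage continuous_intros)
  moreover have bdd: "bdd_below ?S" using sigma_values_nonneg by (rule bdd_belowI)
  ultimately have Inf: "Inf ?S \<in> ?S" by (intro closed_contains_Inf assms)
  have "vertex_sigma A l x i = Inf ?S"
    unfolding vertex_sigma_def using Inf bdd by (intro Least_equality cInf_lower) auto
  then show "vertex_sigma A l x i \<in> ?S" "s \<in> ?S \<Longrightarrow> vertex_sigma A l x i \<le> s"
    using Inf bdd by (auto intro: cInf_lower)
qed

section \<open>Admissible steplengths of the forward Euler method\<close>

lemma euler_step_in_hull_iff: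
  assumes i: "i \<in> {1..l}" and ne: "sigma_values A l x i \<noteq> {}" and "0 \<le> dt"
  shows "forward_euler A dt *v x i \<in> convex hull (x ` {1..l}) \<longleftrightarrow> dt * vertex_sigma A l x i \<le> 1"
proof -
  let ?J = "{1..l} - {i}" and ?\<sigma> = "vertex_sigma A l x i"
  have step: "forward_euler A dt *v x i - x i = dt *\<^sub>R (A *v x i)"
    by (simp add: forward_euler_def matrix_vector_mult_add_rdistrib scaleR_matrix_vector_assoc)
  have hull: "forward_euler A dt *v x i \<in> convex hull (x ` {1..l}) \<longleftrightarrow>
      (\<exists>\<gamma>. (\<forall>j\<in>?J. 0 \<le> \<gamma> j) \<and> sum \<gamma> ?J \<le> 1 \<and>
           dt *\<^sub>R (A *v x i) = (\<Sum>j\<in>?J. \<gamma> j *\<^sub>R (x j - x i)))"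
    using in_convex_hull_image_iff_edge_sum[OF _ i, of _ x] by (simp add: step)
  show ?thesis
  proof
    assume "forward_euler A dt *v x i \<in> convex hull (x ` {1..l})"
    then obtain \<gamma> where \<gamma>: "\<forall>j\<in>?J. 0 \<le> \<gamma> j" "sum \<gamma> ?J \<le> 1"
      "dt *\<^sub>R (A *v x i) = (\<Sum>j\<in>?J. \<gamma> j *\<^sub>R (x j - x i))"
      using hull by blast
    show "dt * ?\<sigma> \<le> 1"
    proof (cases "dt = 0")
      case False
      with \<open>0 \<le> dt\<close> have "dt > 0" by simp
      have "A *v x i = inverse dt *\<^sub>R (dt *\<^sub>R (A *v x i))" using False by simp
      also have "\<dots> = (\<Sum>j\<in>?J. (inverse dt * \<gamma> j) *\<^sub>R (x j - x i))"
        unfolding \<gamma>(3) by (simp add: scaleR_sum_right)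
      finally have "(\<Sum>j\<in>?J. inverse dt * \<gamma> j) \<in> sigma_values A l x i"
        unfolding sigma_values_def using \<gamma>(1) \<open>dt > 0\<close>
        by (intro CollectI exI[of _ "\<lambda>j. inverse dt * \<gamma> j"]) auto
      then have "?\<sigma> \<le> inverse dt * sum \<gamma> ?J"
        using vertex_sigma_is_minimum(2)[OF ne] by (simp add: sum_distrib_left)
      then have "dt * ?\<sigma> \<le> sum \<gamma> ?J" using \<open>dt > 0\<close> by (simp add: field_simps)
      with \<gamma>(2) show ?thesis by simp
    qed simp
  next
    assume le: "dt * ?\<sigma> \<le> 1"
    obtain \<gamma> where \<gamma>: "?\<sigma> = sum \<gamma> ?J" "(\<Sum>j\<in>?J. \<gamma> j *\<^sub>R (x j - x i)) = A *v x i"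
      "\<forall>j\<in>?J. 0 \<le> \<gamma> j"
      using vertex_sigma_is_minimum(1)[OF ne] by (auto simp: sigma_values_def)
    have "dt *\<^sub>R (A *v x i) = (\<Sum>j\<in>?J. (dt * \<gamma> j) *\<^sub>R (x j - x i))"
      unfolding \<gamma>(2)[symmetric] by (simp add: scaleR_sum_right)
    moreover have "(\<Sum>j\<in>?J. dt * \<gamma> j) \<le> 1"
      using le \<gamma>(1) by (simp add: sum_distrib_left)
    ultimately show "forward_euler A dt *v x i \<in> convex hull (x ` {1..l})"
      unfolding hull using \<gamma>(3) \<open>0 \<le> dt\<close> by (intro exI[of _ "\<lambda>j. dt * \<gamma> j"]) auto
  qed
qed

text \<open>For minimal weight \<open>0\<close> the bound is \<open>\<infinity>\<close> and both sides hold for every \<open>dt\<close>.\<close>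

lemma ereal_le_vertex_epsilon_iff:
  assumes "0 \<le> vertex_sigma A l x i"
  shows "ereal dt \<le> vertex_epsilon A l x i \<longleftrightarrow> dt * vertex_sigma A l x i \<le> 1"
  using assms by (auto simp: vertex_epsilon_def field_simps)

lemma largest_steplength_thresholdI:
  assumes "0 < \<tau>"
    and inv: "\<And>dt. 0 \<le> dt \<Longrightarrow> discrete_invariant (D dt) S \<longleftrightarrow> ereal dt \<le> \<tau>"
  shows "largest_steplength_threshold D S \<tau>"
proof -
  have "\<tau>' \<le> \<tau>" if \<tau>': "steplength_threshold D S \<tau>'" for \<tau>'
  proof (rule ccontr)
    assume "\<not> \<tau>' \<le> \<tau>"
    then have "\<tau> < \<tau>'" by simp
    \<comment> \<open>As \<open>\<tau>'\<close> may be \<open>\<infinity>\<close>, a real steplength strictly between the two bounds is used.\<close>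
    then obtain r where r: "\<tau> < ereal r" "ereal r < \<tau>'"
      using ereal_dense2 by blast
    then have "0 < ereal r" using \<open>0 < \<tau>\<close> by (meson less_trans)
    then have "0 \<le> r" by simp
    then have "discrete_invariant (D r) S"
      using \<tau>' r(2) by (simp add: steplength_threshold_def)
    then show False using inv[OF \<open>0 \<le> r\<close>] r(1) by simp
  qed
  then show ?thesis
    using assms by (simp add: largest_steplength_threshold_def steplength_threshold_def)
qed

theorem theorem3p16:
  fixes A :: "real^'n^'n" and P :: "(real^'n) set"
    and l :: nat and x :: "nat \<Rightarrow> real^'n"
  assumes "1 \<le> l"
    and "P = convex hull (x ` {1..l})"
    and "inj_on x {1..l}"
    and "\<forall>i\<in>{1..l}. x i extreme_point_of P"
    and "continuous_invariant A P"
  shows "(\<forall>i\<in>{1..l}. vertex_sigma A l x i \<in> sigma_values A l x i \<and>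
            (\<forall>s\<in>sigma_values A l x i. vertex_sigma A l x i \<le> s)) \<and>
         largest_steplength_threshold (forward_euler A) P
           (MIN i\<in>{1..l}. vertex_epsilon A l x i)"
proof
  have ne: "sigma_values A l x i \<noteq> {}" if "i \<in> {1..l}" for i
    using that assms(2,5) by (intro sigma_values_nonempty) auto
  then show "\<forall>i\<in>{1..l}. vertex_sigma A l x i \<in> sigma_values A l x i \<and>
            (\<forall>s\<in>sigma_values A l x i. vertex_sigma A l x i \<le> s)"
    using vertex_sigma_is_minimum by blast
  have nonneg: "0 \<le> vertex_sigma A l x i" if "i \<in> {1..l}" for i
    using vertex_sigma_is_minimum(1)[OF ne[OF that]] by (rule sigma_values_nonneg)
  have fin: "finite (vertex_epsilon A l x ` {1..l})" "vertex_epsilon A l x ` {1..l} \<noteq> {}"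
    using assms(1) by auto
  show "largest_steplength_threshold (forward_euler A) P
           (MIN i\<in>{1..l}. vertex_epsilon A l x i)"
  proof (rule largest_steplength_thresholdI)
    have "0 < vertex_epsilon A l x i" if "i \<in> {1..l}" for i
      using nonneg[OF that] by (auto simp: vertex_epsilon_def)
    then show "0 < (MIN i\<in>{1..l}. vertex_epsilon A l x i)"
      using fin by (simp add: Min_gr_iff)
    fix dt :: real assume "0 \<le> dt"
    have "discrete_invariant (forward_euler A dt) P \<longleftrightarrow>
        (\<forall>i\<in>{1..l}. forward_euler A dt *v x i \<in> convex hull (x ` {1..l}))"
      by (simp add: assms(2) discrete_invariant_convex_hull_iff)
    also have "\<dots> \<longleftrightarrow> (\<forall>i\<in>{1..l}. dt * vertex_sigma A l x i \<le> 1)"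
      using euler_step_in_hull_iff ne \<open>0 \<le> dt\<close> by blast
    also have "\<dots> \<longleftrightarrow> (\<forall>i\<in>{1..l}. ereal dt \<le> vertex_epsilon A l x i)"
      using ereal_le_vertex_epsilon_iff nonneg by blast
    also have "\<dots> \<longleftrightarrow> ereal dt \<le> (MIN i\<in>{1..l}. vertex_epsilon A l x i)"
      using fin by (simp add: Min_ge_iff)
    finally show "discrete_invariant (forward_euler A dt) P \<longleftrightarrow>
        ereal dt \<le> (MIN i\<in>{1..l}. vertex_epsilon A l x i)" .
  qed
qed

end
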